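(* Let $\mathcal{F}$ be a union-closed family of finite sets with $\emptyset\in\mathcal{F}$ such that every member of $J(\mathcal{F})$ has one or two elements, let $U=\{a,b\}\in J(\mathcal{F})$ with $a\neq b$, and suppose $\mathcal{F}=\mathcal{N}^3_{\mathcal{F}}(U)$. Let $\mathcal{H}$ be a nonempty order filter (up-set) of $2^{N^2\setminus U}$ such that $|E(X)|=1$ for every minimal member $X$ of $\mathcal{H}$, and let $\mathcal{F}'=\mathcal{F}\vee\mathcal{H}$. Then $$\mu_{\mathcal{F},\mathcal{F}'}(U)\ \ge\ 1+\sum_{Y\subsetneq U}\ \prod_{x\in N\setminus U}\nu(\mathcal{E}(Y,x)).$$
   Context: For families $\mathcal{A},\mathcal{B}$, $\mathcal{A}\vee\mathcal{B}=\{A\cup B:A\in\mathcal{A},B\in\mathcal{B}\}$ and $\mathcal{A}_{\setminus Z}=\{A\setminus Z:A\in\mathcal{A}\}$. $J(\mathcal{F})$ is the set of union generators of $\mathcal{F}$ (nonempty $V\in\mathcal{F}$ not equal to the union of the members of $\mathcal{F}$ properly contained in $V$); its members are called edges. $N_{\mathcal{F}}(X)=X\cup\bigcup\{V\in J(\mathcal{F}):V\cap X\neq\emptyset\}$, $N=N_{\mathcal{F}}(U)$, $N^2=N_{\mathcal{F}}(N)$. $\mathcal{N}_{\mathcal{F}}(W)$ is the family of all unions of subfamilies of $\{V\in J(\mathcal{F}):V\cap W\neq\emptyset\}$ (empty union $=\emptyset$), and $\mathcal{N}^3_{\mathcal{F}}(U)=\mathcal{N}_{\mathcal{F}}(\bigcup\mathcal{N}_{\mathcal{F}}(U))$.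 $\pi_{\mathcal{F}}(X)=\bigcup\{V\in\mathcal{F}:V\subseteq X\}$. For $X$ with $X\cap U=\emptyset$, $E(X)$ is the set of $Y\subseteq U$ with $\pi_{\mathcal{F}}(X\cup Y)\cap U=Y$ and $\pi_{\mathcal{F}}(X\cup Y)\supseteq\pi_{\mathcal{F}}(X\cup U)\setminus U$. $\mu_{\mathcal{F},\mathcal{F}'}(U)=\sum_{X\in\mathcal{F}'_{\setminus U}}|E(X)|\,/\,|\mathcal{F}'_{\setminus U}|$. For $Y\subseteq U$ and $x\in N\setminus U$, $\mathcal{E}(Y,x)$ is the family of subsets $X\subseteq N^2\setminus U$ for which there exists $y$ with $\{x,y\}\in J(\mathcal{F})$ and ($y\in X\cup Y$ or $y=x$). For a family $\mathcal{W}\subseteq 2^{N^2\setminus U}$, $\nu(\mathcal{W})=|\mathcal{W}|/2^{|N^2\setminus U|}$. *)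

theory Defs
  imports Complex_Main
begin

definition union_closed :: "'a set set \<Rightarrow> bool" where
  "union_closed F \<longleftrightarrow> (\<forall>A\<in>F. \<forall>B\<in>F. A \<union> B \<in> F)"

definition family_join :: "'a set set \<Rightarrow> 'a set set \<Rightarrow> 'a set set" where
  "family_join F G = {A \<union> B | A B. A \<in> F \<and> B \<in> G}"

definition family_minus :: "'a set set \<Rightarrow> 'a set \<Rightarrow> 'a set set" where
  "family_minus F Z = {A - Z | A. A \<in> F}"

definition union_generators :: "'a set set \<Rightarrow> 'a set set" where
  "union_generators F = {V \<in> F. V \<noteq> {} \<and> V \<noteq> \<Union>{W \<in> F. W \<subset> V}}"

definition nbhd :: "'a set set \<Rightarrow> 'a set \<Rightarrow> 'a set" where
  "nbhd F X = X \<union> \<Union>{V \<in> union_generators F. V \<inter> X \<noteq> {}}"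

definition nbhd_family :: "'a set set \<Rightarrow> 'a set \<Rightarrow> 'a set set" where
  "nbhd_family F W = {\<Union>S | S. S \<subseteq> {V \<in> union_generators F. V \<inter> W \<noteq> {}}}"

definition nbhd_family3 :: "'a set set \<Rightarrow> 'a set \<Rightarrow> 'a set set" where
  "nbhd_family3 F U = nbhd_family F (\<Union>(nbhd_family F U))"

definition family_interior :: "'a set set \<Rightarrow> 'a set \<Rightarrow> 'a set" where
  "family_interior F X = \<Union>{V \<in> F. V \<subseteq> X}"

(* The set E(X); only meant for X disjoint from U. *)
definition traces :: "'a set set \<Rightarrow> 'a set \<Rightarrow> 'a set \<Rightarrow> 'a set set" where
  "traces F U X = {Y. Y \<subseteq> U \<and> family_interior F (X \<union> Y) \<inter> U = Y \<and>
      family_interior F (X \<union> U) - U \<subseteq> family_interior F (X \<union> Y)}"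

definition mu :: "'a set set \<Rightarrow> 'a set set \<Rightarrow> 'a set \<Rightarrow> real" where
  "mu F F' U = (\<Sum>X\<in>family_minus F' U. real (card (traces F U X))) / real (card (family_minus F' U))"

(* The set N^2 - U over which H and the densities nu live. *)
definition outer_ground :: "'a set set \<Rightarrow> 'a set \<Rightarrow> 'a set" where
  "outer_ground F U = nbhd F (nbhd F U) - U"

(* The case y = x covers singleton edges {x}, because {x, x} = {x}. *)
definition edge_event :: "'a set set \<Rightarrow> 'a set \<Rightarrow> 'a set \<Rightarrow> 'a \<Rightarrow> 'a set set" where
  "edge_event F U Y x = {X. X \<subseteq> outer_ground F U \<and>
      (\<exists>y. {x, y} \<in> union_generators F \<and> (y \<in> X \<union> Y \<or> y = x))}"

definition nu :: "'a set set \<Rightarrow> 'a set \<Rightarrow> 'a set set \<Rightarrow> real" where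
  "nu F U W = real (card W) / 2 ^ card (outer_ground F U)"

definition order_filter_on :: "'a set \<Rightarrow> 'a set set \<Rightarrow> bool" where
  "order_filter_on G H \<longleftrightarrow> H \<subseteq> Pow G \<and> (\<forall>A\<in>H. \<forall>B. A \<subseteq> B \<and> B \<subseteq> G \<longrightarrow> B \<in> H)"

definition minimal_members :: "'a set set \<Rightarrow> 'a set set" where
  "minimal_members H = {X \<in> H. \<not> (\<exists>Z\<in>H. Z \<subset> X)}"

end

theory Submission
  imports Defs
begin

text \<open>
  Since \<open>H\<close> is an up-set of the subsets of \<open>N\<^sup>2 - U\<close>, the trace of \<open>F'\<close> outside \<open>U\<close> is \<open>H\<close> itself, so
  \<open>\<mu>\<close> is the mean of \<open>|E(X)|\<close> over \<open>X \<in> H\<close>. Always \<open>U \<in> E(X)\<close>, which yields the summand \<open>1\<close>. If some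
  \<open>c \<in> U\<close> had no neighbour in a minimal member \<open>X\<close> of \<open>H\<close>, then \<open>E(X)\<close> would also contain either
  \<open>\<emptyset>\<close> or \<open>U - {c}\<close>; hence both points of \<open>U\<close> have neighbours in every member of \<open>H\<close>. Therefore a
  set \<open>X \<in> H\<close> lying in all the up-sets \<open>\<E>(Y, x)\<close>, \<open>x \<in> N - U\<close>, satisfies \<open>Y \<in> E(X)\<close>, and Harris'
  inequality bounds the proportion of such \<open>X\<close> in \<open>H\<close> from below by the product of the densities.
\<close>

section \<open>Harris' inequality\<close>

lemma order_filter_onD:
  "order_filter_on G A \<Longrightarrow> X \<in> A \<Longrightarrow> X \<subseteq> Z \<Longrightarrow> Z \<subseteq> G \<Longrightarrow> Z \<in> A"
  unfolding order_filter_on_def by blast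

lemma order_filter_on_subset: "order_filter_on G A \<Longrightarrow> X \<in> A \<Longrightarrow> X \<subseteq> G"
  unfolding order_filter_on_def by blast

lemma order_filter_on_Int:
  "order_filter_on G A \<Longrightarrow> order_filter_on G B \<Longrightarrow> order_filter_on G (A \<inter> B)"
  by (auto simp: order_filter_on_def)

text \<open>Members avoiding \<open>g\<close> are kept and members containing \<open>g\<close> lose
  it, so both kinds are counted inside \<open>Pow G\<close>. This is the splitting that drives the
  induction for Harris' inequality.\<close>

lemma card_split_insert:
  assumes "finite G" "g \<notin> G" "A \<subseteq> Pow (insert g G)"
  shows "card A = card {X \<in> Pow G. X \<in> A} + card {X \<in> Pow G. insert g X \<in> A}"
proof -
  let ?A0 = "{X \<in> Pow G. X \<in> A}" and ?A1 = "{X \<in> Pow G. insert g X \<in> A}"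
  have "A \<subseteq> ?A0 \<union> insert g ` ?A1"
  proof
    fix X assume X: "X \<in> A"
    show "X \<in> ?A0 \<union> insert g ` ?A1"
    proof (cases "g \<in> X")
      case True
      then have "X = insert g (X - {g})" by (simp add: insert_absorb)
      moreover have "X - {g} \<in> ?A1"
        using X True assms(3) by (auto simp: insert_absorb)
      ultimately show ?thesis by (rule UnI2[OF image_eqI])
    next
      case False
      then show ?thesis using X assms(3) by auto
    qed
  qed
  then have "A = ?A0 \<union> insert g ` ?A1"
    by auto
  then have "card A = card (?A0 \<union> insert g ` ?A1)"
    by (rule arg_cong)
  also have "\<dots> = card ?A0 + card (insert g ` ?A1)"
    using assms(1,2) by (intro card_Un_disjoint) auto
  also have "card (insert g ` ?A1) = card ?A1"
  proof (rule card_image)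
    show "inj_on (insert g) ?A1"
    proof (rule inj_onI)
      fix X Y assume *: "X \<in> ?A1" "Y \<in> ?A1" "insert g X = insert g Y"
      then have "g \<notin> X" "g \<notin> Y" using assms(2) by auto
      from insert_ident[OF this] *(3) show "X = Y" by (rule iffD1)
    qed
  qed
  finally show ?thesis .
qed

text \<open>Induction on the ground set. Removing a point \<open>g\<close> splits an up-set into two
  up-sets of the smaller cube, the first contained in the second, so the sizes for \<open>A\<close>
  and \<open>B\<close> are ordered the same way and a two-term Chebyshev inequality combines the two
  induction hypotheses. Multiplying out the densities keeps the statement in the natural
  numbers.\<close>

lemma harris_card:
  assumes "finite G" "order_filter_on G A" "order_filter_on G B"
  shows "card A * card B \<le> card (A \<inter> B) * 2 ^ card G"
  using assms
proof (induction G arbitrary: A B rule: finite_induct)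
  case empty
  then have "A \<subseteq> {{}}" "B \<subseteq> {{}}"
    by (auto simp: order_filter_on_def)
  then have "A = {} \<or> A = {{}}" "B = {} \<or> B = {{}}" by auto
  then show ?case by auto
next
  case (insert g G)
  define lo where "lo C = {X \<in> Pow G. X \<in> C}" for C
  define hi where "hi C = {X \<in> Pow G. insert g X \<in> C}" for C
  have split: "card C = card (lo C) + card (hi C)" if "order_filter_on (insert g G) C" for C
    using card_split_insert[OF insert.hyps, of C] that
    by (simp add: lo_def hi_def order_filter_on_def)
  have lo: "order_filter_on G (lo C)" and hi: "order_filter_on G (hi C)"
    and le: "card (lo C) \<le> card (hi C)" if C: "order_filter_on (insert g G) C" for C
  proof -
    show "order_filter_on G (lo C)"
      unfolding order_filter_on_def lo_def using order_filter_onD[OF C] by blast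
    show "order_filter_on G (hi C)"
      unfolding order_filter_on_def hi_def
      by (auto elim!: order_filter_onD[OF C])
    have "lo C \<subseteq> hi C"
      unfolding lo_def hi_def using order_filter_onD[OF C] by blast
    moreover have "finite (hi C)"
      using insert.hyps(1) by (simp add: hi_def)
    ultimately show "card (lo C) \<le> card (hi C)"
      by (simp add: card_mono)
  qed
  have Int: "lo (A \<inter> B) = lo A \<inter> lo B" "hi (A \<inter> B) = hi A \<inter> hi B"
    by (auto simp: lo_def hi_def)
  note A = insert.prems(1) and B = insert.prems(2)
  \<comment> \<open>Chebyshev's sum inequality for two terms: with \<open>q = p + d\<close> and
    \<open>s = r + e\<close> the two sides differ by exactly \<open>d * e\<close>.\<close>
  have rearr: "(p + q) * (r + s) \<le> 2 * (p * r + q * s)" if le: "p \<le> q" "r \<le> s" for p q r s :: nat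
  proof -
    obtain d e where "q = p + d" "s = r + e"
      using le_Suc_ex[OF le(1)] le_Suc_ex[OF le(2)] by blast
    then show ?thesis by (simp add: algebra_simps)
  qed
  have "card A * card B \<le> 2 * (card (lo A) * card (lo B) + card (hi A) * card (hi B))"
    unfolding split[OF A] split[OF B] by (rule rearr[OF le[OF A] le[OF B]])
  also have "\<dots> \<le> 2 * (card (lo A \<inter> lo B) * 2 ^ card G + card (hi A \<inter> hi B) * 2 ^ card G)"
    using insert.IH[OF lo[OF A] lo[OF B]] insert.IH[OF hi[OF A] hi[OF B]] by simp
  also have "\<dots> = card (A \<inter> B) * 2 ^ card (insert g G)"
    using insert.hyps split[OF order_filter_on_Int[OF A B]] by (simp add: Int algebra_simps)
  finally show ?case .
qed

text \<open>Intersections of up-sets are up-sets, so the two-family inequality can be iterated.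
  Intersecting within \<open>Pow\<close> makes the case of empty \<open>S\<close> the whole cube, of
  density 1.\<close>

lemma harris_prod:
  assumes "finite S" "finite (outer_ground F U)"
    and up: "\<And>x. x \<in> S \<Longrightarrow> order_filter_on (outer_ground F U) (W x)"
  shows "(\<Prod>x\<in>S. nu F U (W x)) \<le> nu F U {X \<in> Pow (outer_ground F U). \<forall>x\<in>S. X \<in> W x}"
  using assms(1) up
proof (induction S rule: finite_induct)
  case empty
  then show ?case
    using assms(2) by (simp add: nu_def card_Pow Pow_def[symmetric])
next
  case (insert s S)
  let ?G = "outer_ground F U"
  let ?I = "{X \<in> Pow ?G. \<forall>x\<in>S. X \<in> W x}"
  have I: "order_filter_on ?G ?I"
    unfolding order_filter_on_def
    using insert.prems by (auto intro: order_filter_onD)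
  have Ws: "order_filter_on ?G (W s)"
    using insert.prems by simp
  have eq: "{X \<in> Pow ?G. \<forall>x\<in>insert s S. X \<in> W x} = W s \<inter> ?I"
    by auto
  have "0 \<le> nu F U (W s)"
    by (simp add: nu_def)
  then have "(\<Prod>x\<in>insert s S. nu F U (W x)) \<le> nu F U (W s) * nu F U ?I"
    using insert.IH insert.prems insert.hyps by (simp add: mult_left_mono)
  also have "\<dots> \<le> nu F U (W s \<inter> ?I)"
  proof -
    have "real (card (W s)) * real (card ?I) \<le> real (card (W s \<inter> ?I)) * 2 ^ card ?G"
      using of_nat_mono[OF harris_card[OF assms(2) Ws I], where 'a = real] by simp
    then show ?thesis
      by (simp add: nu_def field_simps)
  qed
  finally show ?case
    unfolding eq .
qed

section \<open>Union generators\<close>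

text \<open>A member that is not a generator is the union of its proper submembers, one of which
  contains \<open>v\<close>; since members are finite, this descent ends at a generator.\<close>

lemma union_generators_cover:
  assumes "\<forall>A\<in>F. finite A" "A \<in> F" "v \<in> A"
  shows "\<exists>V\<in>union_generators F. v \<in> V \<and> V \<subseteq> A"
proof -
  have "finite A" using assms by blast
  then show ?thesis
    using assms(2,3)
  proof (induction A rule: finite_psubset_induct)
    case (psubset A)
    show ?case
    proof (cases "A \<in> union_generators F")
      case False
      then have "A = \<Union>{B \<in> F. B \<subset> A}"
        using psubset.prems by (auto simp: union_generators_def)
      with psubset.prems(2) have "v \<in> \<Union>{B \<in> F. B \<subset> A}"
        by (rule back_subst)
      then obtain B where B: "B \<in> F" "B \<subset> A" "v \<in> B"
        by blast
      from psubset.IH[OF B(2,1,3)] B(2) show ?thesis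
        by (meson psubset_imp_subset subset_trans)
    qed (use psubset.prems(2) in blast)
  qed
qed

lemma family_interior_iff:
  assumes "\<forall>A\<in>F. finite A"
  shows "v \<in> family_interior F X \<longleftrightarrow> (\<exists>V\<in>union_generators F. v \<in> V \<and> V \<subseteq> X)"
proof
  assume "v \<in> family_interior F X"
  then obtain A where "A \<in> F" "A \<subseteq> X" "v \<in> A"
    by (auto simp: family_interior_def)
  from union_generators_cover[OF assms \<open>A \<in> F\<close> \<open>v \<in> A\<close>]
  show "\<exists>V\<in>union_generators F. v \<in> V \<and> V \<subseteq> X"
    using \<open>A \<subseteq> X\<close> by (meson subset_trans)
next
  assume "\<exists>V\<in>union_generators F. v \<in> V \<and> V \<subseteq> X"
  then obtain V where "V \<in> F" "v \<in> V" "V \<subseteq> X"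
    by (auto simp: union_generators_def)
  then show "v \<in> family_interior F X"
    unfolding family_interior_def by blast
qed

text \<open>Allowing \<open>w = v\<close> treats one-point and two-point edges alike.\<close>

lemma edge_through:
  assumes "card V = 1 \<or> card V = 2" "v \<in> V"
  obtains w where "V = {v, w}"
proof -
  have "\<exists>w. V = {v, w}"
    using assms by (auto simp: card_1_singleton_iff card_2_iff)
  then show ?thesis using that by blast
qed

section \<open>Neighbourhoods and the trace of the join outside \<open>U\<close>\<close>

lemma Union_nbhd_family: "\<Union>(nbhd_family F W) = \<Union>{V \<in> union_generators F. V \<inter> W \<noteq> {}}"
  unfolding nbhd_family_def by blast

lemma nbhd_eq_Union:
  assumes "U \<in> union_generators F"
  shows "nbhd F U = \<Union>{V \<in> union_generators F. V \<inter> U \<noteq> {}}"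
proof -
  have "U \<subseteq> \<Union>{V \<in> union_generators F. V \<inter> U \<noteq> {}}"
    using assms by (intro Union_upper) (simp add: union_generators_def)
  then show ?thesis
    unfolding nbhd_def by (rule Un_absorb1)
qed

lemma nbhd_family3_eq:
  "U \<in> union_generators F \<Longrightarrow> nbhd_family3 F U = nbhd_family F (nbhd F U)"
  by (simp add: nbhd_family3_def Union_nbhd_family nbhd_eq_Union)

text \<open>The union of all edges meeting \<open>N\<close> is itself a member of
  \<open>F = nbhd_family3 F U\<close>, hence finite. It covers \<open>N\<close> because every edge
  meeting \<open>U\<close> also meets \<open>N\<close>.\<close>

lemma finite_nbhd2:
  assumes fin: "\<forall>A\<in>F. finite A" and U: "U \<in> union_generators F" and F: "F = nbhd_family3 F U"
  shows "finite (nbhd F (nbhd F U))"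
proof -
  let ?E = "{V \<in> union_generators F. V \<inter> nbhd F U \<noteq> {}}"
  have "\<Union>?E \<in> nbhd_family3 F U"
    unfolding nbhd_family3_eq[OF U] nbhd_family_def by blast
  then have E: "finite (\<Union>?E)"
    using fin F[symmetric] by simp
  have "U \<subseteq> nbhd F U"
    by (simp add: nbhd_def)
  then have "{V \<in> union_generators F. V \<inter> U \<noteq> {}} \<subseteq> ?E"
    by blast
  then have "nbhd F U \<subseteq> \<Union>?E"
    by (subst (1) nbhd_eq_Union[OF U]) (rule Union_mono)
  then have "finite (nbhd F U)"
    using E by (rule finite_subset)
  then show ?thesis
    using E unfolding nbhd_def[of F "nbhd F U"] by (rule finite_UnI)
qed

lemma subset_nbhd2:
  assumes U: "U \<in> union_generators F" and F: "F = nbhd_family3 F U" and A: "A \<in> F"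
  shows "A \<subseteq> nbhd F (nbhd F U)"
proof -
  have "A \<in> nbhd_family F (nbhd F U)"
    using A nbhd_family3_eq[OF U] F[symmetric] by simp
  then have "A \<subseteq> \<Union>(nbhd_family F (nbhd F U))"
    by (rule Union_upper)
  then show ?thesis
    unfolding Union_nbhd_family nbhd_def[of F "nbhd F U"] by (rule le_supI2)
qed

text \<open>For \<open>B\<close> in \<open>H\<close> the set \<open>A \<union> B - U\<close>
  contains \<open>B\<close> and stays in \<open>G\<close>, so up-closure puts it in
  \<open>H\<close>. Conversely, joining with the empty member of \<open>F\<close> reproduces every
  member of \<open>H\<close>.\<close>

lemma family_minus_join:
  assumes "{} \<in> F" "\<And>A. A \<in> F \<Longrightarrow> A - U \<subseteq> G" "order_filter_on G H" "G \<inter> U = {}"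
  shows "family_minus (family_join F H) U = H"
proof (intro set_eqI iffI)
  fix X assume "X \<in> family_minus (family_join F H) U"
  then obtain A B where AB: "A \<in> F" "B \<in> H" "X = A \<union> B - U"
    unfolding family_minus_def family_join_def by blast
  have "B \<subseteq> G"
    by (rule order_filter_on_subset[OF assms(3) AB(2)])
  then have "B \<subseteq> X" "X \<subseteq> G"
    using AB assms(2)[OF AB(1)] assms(4) by blast+
  then show "X \<in> H"
    using AB(2) order_filter_onD[OF assms(3)] by blast
next
  fix X assume X: "X \<in> H"
  then have "X = {} \<union> X - U"
    using order_filter_on_subset[OF assms(3) X] assms(4) by blast
  moreover have "{} \<union> X \<in> family_join F H"
    unfolding family_join_def using X assms(1) by blast
  ultimately show "X \<in> family_minus (family_join F H) U"
    unfolding family_minus_def by blast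
qed

lemma order_filter_on_edge_event: "order_filter_on (outer_ground F U) (edge_event F U Y x)"
  unfolding order_filter_on_def edge_event_def by (auto dest: subsetD)

section \<open>The traces \<open>E(X)\<close>\<close>

lemma self_in_traces:
  assumes "U \<in> F"
  shows "U \<in> traces F U X"
proof -
  have "U \<subseteq> family_interior F (X \<union> U)"
    unfolding family_interior_def using assms by (intro Union_upper) simp
  then show ?thesis
    by (auto simp: traces_def)
qed

text \<open>If \<open>c\<close> had no neighbour in \<open>X\<close>, no edge inside
  \<open>X \<union> U\<close> could join \<open>c\<close> to an outside point, so dropping
  \<open>c\<close> would lose no outside point of the interior. This yields a second trace besides
  \<open>U\<close>.\<close>

lemma neighbour_in_singleton_trace:
  assumes fin: "\<forall>A\<in>F. finite A" and edges: "\<forall>V\<in>union_generators F. card V = 1 \<or> card V = 2"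
    and U: "U = {c, d}" "U \<in> union_generators F" and "c \<noteq> d"
    and X: "X \<inter> U = {}" and one: "card (traces F U X) = 1"
  shows "\<exists>n\<in>X. {c, n} \<in> union_generators F"
proof (rule ccontr)
  assume no: "\<not> ?thesis"
  note interior = family_interior_iff[OF fin]
  have "U \<in> traces F U X"
    using U(2) by (intro self_in_traces) (simp add: union_generators_def)
  then have only: "traces F U X = {U}"
    using one by (auto simp: card_1_singleton_iff)
  \<comment> \<open>Such an edge is \<open>{v, w}\<close> with \<open>v\<close> in \<open>X\<close>;
    \<open>w = c\<close> would make \<open>v\<close> a neighbour of \<open>c\<close>.\<close>
  have avoid: "V \<subseteq> X \<union> {d}" if V: "V \<in> union_generators F" "V \<subseteq> X \<union> U" "v \<in> V" "v \<notin> U" for V v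
  proof -
    have "v \<in> X" using V by blast
    obtain w where w: "V = {v, w}"
      using edge_through edges V by metis
    have "w \<noteq> c"
      using no V(1) w \<open>v \<in> X\<close> by (auto simp: insert_commute)
    then show ?thesis
      using w V U by auto
  qed
  show False
  proof (cases "\<exists>V\<in>union_generators F. d \<in> V \<and> V \<subseteq> X \<union> {d}")
    case True
    have "family_interior F (X \<union> {d}) \<inter> U = {d}"
      using True X U(1) \<open>c \<noteq> d\<close> by (auto simp: interior)
    moreover have "family_interior F (X \<union> U) - U \<subseteq> family_interior F (X \<union> {d})"
    proof
      fix v assume "v \<in> family_interior F (X \<union> U) - U"
      then obtain V where "V \<in> union_generators F" "v \<in> V" "V \<subseteq> X \<union> U" "v \<notin> U"
        by (auto simp: interior)
      then show "v \<in> family_interior F (X \<union> {d})"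
        using avoid unfolding interior by blast
    qed
    ultimately have "{d} \<in> traces F U X"
      using U(1) by (simp add: traces_def)
    then show False
      using only U(1) \<open>c \<noteq> d\<close> by auto
  next
    case False
    have "family_interior F (X \<union> {}) \<subseteq> X"
      by (auto simp: family_interior_def)
    then have "family_interior F (X \<union> {}) \<inter> U = {}"
      using X by blast
    moreover have "family_interior F (X \<union> U) - U \<subseteq> family_interior F (X \<union> {})"
    proof
      fix v assume "v \<in> family_interior F (X \<union> U) - U"
      then obtain V where V: "V \<in> union_generators F" "v \<in> V" "V \<subseteq> X \<union> U" "v \<notin> U"
        by (auto simp: interior)
      then have "V \<subseteq> X \<union> {d}" using avoid by blast
      moreover from this have "d \<notin> V" using False V(1) by blast
      ultimately have "V \<subseteq> X \<union> {}" by blast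
      then show "v \<in> family_interior F (X \<union> {})"
        using V unfolding interior by blast
    qed
    ultimately have "{} \<in> traces F U X"
      by (simp add: traces_def)
    then show False
      using only U(1) by auto
  qed
qed

text \<open>The neighbours in \<open>X\<close> put \<open>Y\<close> into the interior of
  \<open>X \<union> Y\<close>. An outside point can only be lost through an edge meeting
  \<open>U\<close>, so it lies in \<open>N\<close>, where its event supplies a replacement
  edge.\<close>

lemma trace_if_edge_events:
  assumes fin: "\<forall>A\<in>F. finite A" and "Y \<subseteq> U" and X: "X \<inter> U = {}"
    and nb: "\<And>y. y \<in> Y \<Longrightarrow> \<exists>n\<in>X. {y, n} \<in> union_generators F"
    and ev: "\<And>x. x \<in> nbhd F U - U \<Longrightarrow> X \<in> edge_event F U Y x"
  shows "Y \<in> traces F U X"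
proof -
  note interior = family_interior_iff[OF fin]
  have "family_interior F (X \<union> Y) \<subseteq> X \<union> Y"
    by (auto simp: family_interior_def)
  then have "family_interior F (X \<union> Y) \<inter> U \<subseteq> Y"
    using X by blast
  moreover have "Y \<subseteq> family_interior F (X \<union> Y)"
  proof
    fix y assume "y \<in> Y"
    then obtain n where n: "n \<in> X" "{y, n} \<in> union_generators F"
      using nb by blast
    then have "{y, n} \<subseteq> X \<union> Y"
      using \<open>y \<in> Y\<close> by blast
    then show "y \<in> family_interior F (X \<union> Y)"
      unfolding interior by (intro bexI[OF _ n(2)]) simp
  qed
  moreover have "family_interior F (X \<union> U) - U \<subseteq> family_interior F (X \<union> Y)"
  proof
    fix v assume "v \<in> family_interior F (X \<union> U) - U"
    then obtain V where V: "V \<in> union_generators F" "v \<in> V" "V \<subseteq> X \<union> U" "v \<notin> U"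
      by (auto simp: interior)
    then have "v \<in> X" by blast
    show "v \<in> family_interior F (X \<union> Y)"
    \<comment> \<open>An edge missing \<open>U\<close> survives unchanged. An edge meeting
      \<open>U\<close> may use a point outside \<open>Y\<close>, so it is exchanged for the edge
      given by the event at \<open>v\<close>.\<close>
    proof (cases "V \<inter> U = {}")
      case True
      then have "V \<subseteq> X \<union> Y" using V by blast
      then show ?thesis using V unfolding interior by blast
    next
      case False
      then have "v \<in> nbhd F U - U"
        using V unfolding nbhd_def by blast
      from ev[OF this] obtain y
        where y: "{v, y} \<in> union_generators F" "y \<in> X \<union> Y \<or> y = v"
        unfolding edge_event_def by blast
      then have "{v, y} \<subseteq> X \<union> Y"
        using \<open>v \<in> X\<close> by blast
      then show ?thesis
        unfolding interior by (intro bexI[OF _ y(1)]) simp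
    qed
  qed
  ultimately show ?thesis
    using \<open>Y \<subseteq> U\<close> unfolding traces_def by blast
qed

text \<open>Double counting of the pairs \<open>(X, Y)\<close> with \<open>Y\<close> a trace of
  \<open>X\<close>. The choice \<open>Y = U\<close> works for every \<open>X\<close> and accounts
  for the term \<open>card H\<close>.\<close>

lemma sum_card_traces:
  assumes "finite U" "finite H" "U \<in> F"
  shows "(\<Sum>X\<in>H. card (traces F U X)) = card H + (\<Sum>Y | Y \<subset> U. card {X \<in> H. Y \<in> traces F U X})"
proof -
  have fin: "finite {Y. Y \<subset> U}"
    using assms(1) by (auto intro: finite_subset[of _ "Pow U"])
  have "card (traces F U X) = 1 + (\<Sum>Y | Y \<subset> U. of_bool (Y \<in> traces F U X))" for X
  proof -
    have "traces F U X = insert U {Y \<in> {Y. Y \<subset> U}. Y \<in> traces F U X}"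
      using self_in_traces[OF assms(3)] by (auto simp: traces_def)
    then have "card (traces F U X) = card (insert U {Y \<in> {Y. Y \<subset> U}. Y \<in> traces F U X})"
      by simp
    then show ?thesis
      using fin by (simp add: sum_of_bool_eq Int_def)
  qed
  then have "(\<Sum>X\<in>H. card (traces F U X))
      = card H + (\<Sum>X\<in>H. \<Sum>Y | Y \<subset> U. of_bool (Y \<in> traces F U X))"
    by (simp only: sum.distrib card_eq_sum)
  also have "(\<Sum>X\<in>H. \<Sum>Y | Y \<subset> U. of_bool (Y \<in> traces F U X))
      = (\<Sum>Y | Y \<subset> U. \<Sum>X\<in>H. of_bool (Y \<in> traces F U X) :: nat)"
    by (rule sum.swap)
  also have "\<dots> = (\<Sum>Y | Y \<subset> U. card {X \<in> H. Y \<in> traces F U X})"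
    using assms(2) by (simp add: sum_of_bool_eq Int_def)
  finally show ?thesis .
qed

section \<open>The lower bound for the mean number of traces\<close>

theorem theorem3p26:
  fixes F F' H :: "'a set set" and U :: "'a set" and a b :: 'a
  assumes "union_closed F"
    and "\<forall>A\<in>F. finite A"
    and "{} \<in> F"
    and "\<forall>V\<in>union_generators F. card V = 1 \<or> card V = 2"
    and "U = {a, b}" and "a \<noteq> b" and "U \<in> union_generators F"
    and "F = nbhd_family3 F U"
    and "order_filter_on (outer_ground F U) H" and "H \<noteq> {}"
    and "\<forall>X\<in>minimal_members H. card (traces F U X) = 1"
    and "F' = family_join F H"
  shows "mu F F' U \<ge> 1 + (\<Sum>Y | Y \<subset> U. \<Prod>x\<in>nbhd F U - U. nu F U (edge_event F U Y x))"
proof -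
  let ?G = "outer_ground F U" and ?N = "nbhd F U - U"
  note fin = assms(2) and H = assms(9)
  have finN2: "finite (nbhd F (nbhd F U))"
    by (rule finite_nbhd2) fact+
  then have finG: "finite ?G" by (simp add: outer_ground_def)
  have finN: "finite ?N"
    using finN2 unfolding nbhd_def[of F "nbhd F U"] by simp
  have GU: "?G \<inter> U = {}" by (auto simp: outer_ground_def)
  have HG: "H \<subseteq> Pow ?G" using H by (simp add: order_filter_on_def)
  then have finH: "finite H" using finG by (simp add: finite_subset)
  have "A - U \<subseteq> ?G" if "A \<in> F" for A
    using subset_nbhd2[OF assms(7,8) that] unfolding outer_ground_def by blast
  then have F'H: "family_minus F' U = H"
    unfolding assms(12) using assms(3) H GU by (intro family_minus_join)
  have nb: "\<exists>n\<in>X. {c, n} \<in> union_generators F" if X: "X \<in> H" and c: "c \<in> U" for X c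
  proof -
    \<comment> \<open>Neighbours found in a minimal member below \<open>X\<close> are also
      neighbours in \<open>X\<close>.\<close>
    obtain M where M: "M \<in> H" "M \<subseteq> X" "\<And>Z. Z \<in> H \<Longrightarrow> Z \<subseteq> M \<Longrightarrow> Z = M"
      using finite_has_minimal2[OF finH X] by metis
    then have "M \<in> minimal_members H"
      unfolding minimal_members_def by blast
    then have one: "card (traces F U M) = 1" using assms(11) by blast
    have "M \<inter> U = {}" using M(1) HG GU by blast
    moreover obtain d where "U = {c, d}" "c \<noteq> d"
      using c assms(5,6) by auto
    ultimately show ?thesis
      using neighbour_in_singleton_trace[OF fin assms(4) _ assms(7) _ _ one] M(2) by blast
  qed
  have bound: "(\<Prod>x\<in>?N. nu F U (edge_event F U Y x))
      \<le> real (card {X \<in> H. Y \<in> traces F U X}) / real (card H)" if Y: "Y \<subset> U" for Y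
  proof -
    let ?I = "{X \<in> Pow ?G. \<forall>x\<in>?N. X \<in> edge_event F U Y x}"
    have up: "order_filter_on ?G ?I"
      unfolding order_filter_on_def
      by (auto intro: order_filter_onD[OF order_filter_on_edge_event])
    have "H \<inter> ?I \<subseteq> {X \<in> H. Y \<in> traces F U X}"
    proof
      fix X assume "X \<in> H \<inter> ?I"
      moreover from this have "X \<inter> U = {}" using GU by blast
      ultimately show "X \<in> {X \<in> H. Y \<in> traces F U X}"
        using trace_if_edge_events[OF fin, of Y U X] nb Y by blast
    qed
    then have le: "card (H \<inter> ?I) \<le> card {X \<in> H. Y \<in> traces F U X}"
      using finH by (simp add: card_mono)
    \<comment> \<open>Harris applied to \<open>H\<close> against the joint event: the share of
      \<open>?I\<close> within \<open>H\<close> is at least its density in the whole cube.\<close>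
    have "card H * card ?I \<le> card (H \<inter> ?I) * 2 ^ card ?G"
      by (rule harris_card[OF finG H up])
    also have "\<dots> \<le> card {X \<in> H. Y \<in> traces F U X} * 2 ^ card ?G"
      using le by simp
    finally have "real (card H * card ?I) \<le> real (card {X \<in> H. Y \<in> traces F U X} * 2 ^ card ?G)"
      by (rule of_nat_mono)
    then have "real (card H) * real (card ?I)
        \<le> real (card {X \<in> H. Y \<in> traces F U X}) * 2 ^ card ?G"
      by simp
    moreover have "card H > 0"
      using finH assms(10) by (simp add: card_gt_0_iff)
    ultimately have "nu F U ?I \<le> real (card {X \<in> H. Y \<in> traces F U X}) / real (card H)"
      by (simp add: nu_def field_simps)
    with harris_prod[OF finN finG order_filter_on_edge_event] show ?thesis
      by (rule order_trans)
  qed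
  have cH: "real (card H) \<noteq> 0"
    using finH assms(10) by simp
  have UF: "U \<in> F" using assms(7) by (simp add: union_generators_def)
  have "mu F F' U = real (\<Sum>X\<in>H. card (traces F U X)) / real (card H)"
    by (simp add: mu_def F'H)
  also have "\<dots> = 1 + (\<Sum>Y | Y \<subset> U. real (card {X \<in> H. Y \<in> traces F U X}) / real (card H))"
    using cH finH UF assms(5)
    by (simp add: sum_card_traces add_divide_distrib sum_divide_distrib)
  also have "\<dots> \<ge> 1 + (\<Sum>Y | Y \<subset> U. \<Prod>x\<in>?N. nu F U (edge_event F U Y x))"
    using bound by (intro add_left_mono sum_mono) simp
  finally show ?thesis .
qed

end
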